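(* Let $A, B \in \mathbb{C}^{n \times n}$. If $C = A + B$, then $$|\Lambda(C)| \le (\mathrm{rank}(B) + 1)\,|\Lambda(A)| + d(A).$$
   Context: For a square complex matrix $M$, $\Lambda(M)$ denotes the set of distinct eigenvalues of $M$, and $|\Lambda(M)|$ its cardinality. For $\lambda \in \Lambda(M)$, $m_a(M,\lambda)$ and $m_g(M,\lambda)$ denote the algebraic and geometric multiplicity of $\lambda$ as an eigenvalue of $M$. The defectivity of an eigenvalue $\lambda$ of $M$ is $d(M,\lambda) = m_a(M,\lambda) - m_g(M,\lambda) \ge 0$. The defectivity of the matrix $M$ is $d(M) = \sum_{\lambda \in \Lambda(M)} \big(m_a(M,\lambda) - m_g(M,\lambda)\big)$. *)

theory Defs
  imports
    "Jordan_Normal_Form.Char_Poly"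
    "Jordan_Normal_Form.Matrix_Kernel"
    "Jordan_Normal_Form.DL_Rank"
    "Jordan_Normal_Form.Spectral_Radius"
begin

definition alg_mult :: "complex mat \<Rightarrow> complex \<Rightarrow> nat" where
  "alg_mult M \<mu> = order \<mu> (char_poly M)"

(* char_matrix M \<mu> is M - \<mu> I, so its kernel is the eigenspace of \<mu>. *)
definition geom_mult :: "complex mat \<Rightarrow> complex \<Rightarrow> nat" where
  "geom_mult M \<mu> = kernel_dim (char_matrix M \<mu>)"

(* Integer-valued, so that the subtraction is not truncated. *)
definition eig_defectivity :: "complex mat \<Rightarrow> complex \<Rightarrow> int" where
  "eig_defectivity M \<mu> = int (alg_mult M \<mu>) - int (geom_mult M \<mu>)"

definition defectivity :: "complex mat \<Rightarrow> int" where
  "defectivity M = (\<Sum>\<mu>\<in>spectrum M. eig_defectivity M \<mu>)"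

end

theory Submission
  imports Defs "Jordan_Normal_Form.Jordan_Normal_Form_Uniqueness"
    "Jordan_Normal_Form.Jordan_Normal_Form_Existence"
begin

text \<open>
  Every eigenvalue of \<open>C\<close> consumes at least one unit of the total algebraic multiplicity \<open>n\<close>, so
  there can be few new eigenvalues if \<open>C\<close> still spends much of that total on the eigenvalues of
  \<open>A\<close>. It does: perturbing by \<open>B\<close> lowers the dimension of an eigenspace by at most
  \<open>rank B\<close> (\<open>geom_mult_le_geom_mult_add\<close>), and algebraic multiplicity dominates geometric
  multiplicity (\<open>geom_mult_le_alg_mult\<close>), hence each \<open>\<mu>\<close> in the spectrum of \<open>A\<close> satisfies
  \<open>alg_mult C \<mu> \<ge> geom_mult A \<mu> - rank B\<close>. As the algebraic multiplicities of \<open>A\<close> also add up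
  to \<open>n\<close> (\<open>sum_alg_mult_spectrum\<close>), the number of eigenvalues of \<open>C\<close> outside the spectrum of
  \<open>A\<close> is at most
  \<open>(\<Sum>\<mu>\<in>spectrum A. alg_mult A \<mu> - (geom_mult A \<mu> - rank B))\<close>, that is,
  \<open>defectivity A + rank B * card (spectrum A)\<close>. The eigenvalues that \<open>C\<close> shares with \<open>A\<close>
  number at most \<open>card (spectrum A)\<close>, which turns the factor \<open>rank B\<close> into \<open>rank B + 1\<close>.
\<close>

text \<open>
  The rank is defined through the span of the set of columns, in which repeated columns collapse,
  whereas rank-nullity speaks of the image of a linear map. Passing through linear combinations of
  the list of columns connects the two, as these are exactly the products of the matrix with
  coefficient vectors.
\<close>

lemma (in vec_space) span_cols_eq_image:
  assumes M: "M \<in> carrier_mat n m"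
  shows "span (set (cols M)) = (\<lambda>v. M *\<^sub>v v) ` carrier_vec m"
proof -
  have sub: "set (cols M) \<subseteq> carrier_vec n"
    using cols_dim[of M] M by auto
  have len: "length (cols M) = m"
    using M by simp
  have rep: "lincomb_list f (cols M) = M *\<^sub>v vec m f" for f
  proof -
    have "lincomb_list f (cols M) = mat_of_cols n (cols M) *\<^sub>v vec (length (cols M)) f"
      by (rule lincomb_list_as_mat_mult) (use sub in auto)
    then show ?thesis
      using M len mat_of_cols_cols[of M] by simp
  qed
  have "span (set (cols M)) = span_list (cols M)"
    using span_list_as_span[OF sub] by simp
  also have "\<dots> = range (\<lambda>f. M *\<^sub>v vec m f)"
    unfolding span_list_def rep by auto
  also have "\<dots> = (\<lambda>v. M *\<^sub>v v) ` carrier_vec m"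
  proof
    show "range (\<lambda>f. M *\<^sub>v vec m f) \<subseteq> (\<lambda>v. M *\<^sub>v v) ` carrier_vec m"
      by auto
    show "(\<lambda>v. M *\<^sub>v v) ` carrier_vec m \<subseteq> range (\<lambda>f. M *\<^sub>v vec m f)"
    proof
      fix w assume "w \<in> (\<lambda>v. M *\<^sub>v v) ` carrier_vec m"
      then obtain v where v: "v \<in> carrier_vec m" and w: "w = M *\<^sub>v v"
        by auto
      have "v = vec m (\<lambda>i. v $ i)"
        using v by auto
      then show "w \<in> range (\<lambda>f. M *\<^sub>v vec m f)"
        unfolding w by (metis rangeI)
    qed
  qed
  finally show ?thesis .
qed

text \<open>
  Rank-nullity for the linear map that multiplies a vector by \<open>M\<close>.
\<close>

lemma rank_plus_kernel_dim:
  fixes M :: "'a :: field mat"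
  assumes M: "M \<in> carrier_mat n m"
  shows "vec_space.rank n M + kernel_dim M = m"
proof -
  interpret W: vec_space "TYPE('a)" n .
  interpret V: vec_space "TYPE('a)" m .
  interpret K: kernel n m M
    by unfold_locales (rule M)
  have "(\<lambda>v. M *\<^sub>v v) \<in> LinearCombinations.module_hom class_ring V.V W.V"
    unfolding LinearCombinations.module_hom_def mem_Collect_eq using M
    by (simp add: Pi_iff mult_add_distrib_mat_vec[OF M] mult_mat_vec[OF M] module_vec_simps)
  then interpret T: linear_map class_ring V.V W.V "\<lambda>v. M *\<^sub>v v"
    by unfold_locales
  have im: "T.imT = W.span (set (cols M))"
    unfolding T.im_def W.span_cols_eq_image[OF M] by (simp add: module_vec_simps)
  have ker: "T.kerT = mat_kernel M"
    unfolding T.ker_def mat_kernel[OF M] by (simp add: module_vec_simps)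
  have "vectorspace.dim class_ring (W.vs T.imT) + vectorspace.dim class_ring (V.vs T.kerT) = V.dim"
    by (rule T.rank_nullity) simp
  moreover have "kernel_dim M = vectorspace.dim class_ring (V.vs T.kerT)"
    using K.kernel_dim unfolding ker by simp
  ultimately show ?thesis
    unfolding W.rank_def im V.dim_is_n by simp
qed

text \<open>
  By rank-nullity this is subadditivity of the rank, read in terms of nullities.
\<close>

lemma kernel_dim_le_kernel_dim_add:
  fixes M N :: "'a :: field mat"
  assumes M: "M \<in> carrier_mat n m" and N: "N \<in> carrier_mat n m"
  shows "kernel_dim M \<le> kernel_dim (M + N) + vec_space.rank n N"
proof -
  interpret vec_space "TYPE('a)" n .
  have "rank (M + N) \<le> rank M + rank N"
    by (rule rank_subadditive[OF M N])
  moreover have "rank M + kernel_dim M = m" "rank (M + N) + kernel_dim (M + N) = m"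
    using rank_plus_kernel_dim[OF M] rank_plus_kernel_dim[of "M + N" n m] M N by auto
  ultimately show ?thesis by linarith
qed

text \<open>
  Subtracting \<open>\<mu> I\<close> commutes with adding \<open>B\<close>, so the kernel estimate applies to each
  characteristic matrix.
\<close>

lemma geom_mult_le_geom_mult_add:
  assumes A: "A \<in> carrier_mat n n" and B: "B \<in> carrier_mat n n"
  shows "geom_mult A \<mu> \<le> geom_mult (A + B) \<mu> + vec_space.rank n B"
proof -
  have "char_matrix (A + B) \<mu> = char_matrix A \<mu> + B"
    using A B unfolding char_matrix_def by (intro eq_matI) auto
  then show ?thesis
    using kernel_dim_le_kernel_dim_add[of "char_matrix A \<mu>" n n B] A B
    unfolding geom_mult_def by simp
qed

text \<open>
  In a Jordan normal form, the geometric multiplicity counts the blocks that belong to \<open>\<mu>\<close>, while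
  the algebraic multiplicity adds up their sizes.
\<close>

lemma geom_mult_le_alg_mult:
  assumes A: "A \<in> carrier_mat n n"
  shows "geom_mult A \<mu> \<le> alg_mult A \<mu>"
proof -
  obtain as where "char_poly A = (\<Prod>a\<leftarrow>as. [:- a, 1:])"
    using char_poly_factorized[OF A] by blast
  then obtain bs where bs: "jordan_nf A bs"
    using jordan_nf_exists[OF A] by blast
  have "char_matrix A \<mu> \<in> carrier_mat n n"
    using A by simp
  then have "geom_mult A \<mu> = dim_gen_eigenspace A \<mu> 1"
    unfolding geom_mult_def dim_gen_eigenspace_def by simp
  also have "\<dots> = (\<Sum>k\<leftarrow>map fst [(k, e)\<leftarrow>bs. e = \<mu>]. min 1 k)"
    by (rule dim_gen_eigenspace[OF bs])
  also have "\<dots> \<le> sum_list (map fst [b\<leftarrow>bs. snd b = \<mu>])"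
    by (induction bs) auto
  also have "\<dots> = alg_mult A \<mu>"
    unfolding alg_mult_def jordan_nf_order[OF bs] ..
  finally show ?thesis .
qed

lemma order_prod_linear_factors:
  fixes as :: "'a :: idom list"
  shows "order x (\<Prod>a\<leftarrow>as. [:- a, 1:]) = count_list as x"
proof (induction as)
  case (Cons a as)
  have "order x [:- a, 1:] = (if x = a then 1 else 0)"
    using order_linear_power[of x "- a" 1] unfolding power_one_right by simp
  moreover have "[:- a, 1:] * (\<Prod>a\<leftarrow>as. [:- a, 1:]) \<noteq> 0"
    by (auto simp del: mult_pCons_left)
  ultimately show ?case
    using Cons.IH by (simp add: order_mult del: mult_pCons_left)
qed simp

text \<open>
  Over the complex numbers the characteristic polynomial is a product of \<open>n\<close> linear factors, and
  grouping equal factors sorts them by eigenvalue.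
\<close>

lemma sum_alg_mult_spectrum:
  assumes A: "A \<in> carrier_mat n n"
  shows "(\<Sum>\<mu>\<in>spectrum A. alg_mult A \<mu>) = n"
proof -
  obtain as where as: "char_poly A = (\<Prod>a\<leftarrow>as. [:- a, 1:])" and len: "length as = n"
    using char_poly_factorized[OF A] by blast
  have "spectrum A = set as"
    unfolding spectrum_root_char_poly[OF A] as
    by (auto simp: poly_prod_list)
  then show ?thesis
    using sum_count_set[of as "set as"] len
    unfolding alg_mult_def as order_prod_linear_factors by simp
qed

lemma alg_mult_pos_iff:
  assumes A: "A \<in> carrier_mat n n"
  shows "alg_mult A \<mu> > 0 \<longleftrightarrow> \<mu> \<in> spectrum A"
proof -
  have "char_poly A \<noteq> 0"
    using degree_monic_char_poly[OF A] by auto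
  then show ?thesis
    using order_root[of "char_poly A" \<mu>]
    unfolding alg_mult_def spectrum_root_char_poly[OF A] by simp
qed

theorem theorem1p3:
  fixes A B C :: "complex mat" and n :: nat
  assumes "A \<in> carrier_mat n n"
    and "B \<in> carrier_mat n n"
    and "C = A + B"
  shows "int (card (spectrum C))
    \<le> (int (vec_space.rank n B) + 1) * int (card (spectrum A)) + defectivity A"
proof -
  let ?r = "int (vec_space.rank n B)"
  note A = assms(1) and B = assms(2)
  have C: "C \<in> carrier_mat n n"
    using assms by simp
  have finA: "finite (spectrum A)" and finC: "finite (spectrum C)"
    using card_finite_spectrum A C by auto
  let ?a = "\<lambda>\<mu>. int (alg_mult C \<mu>)"
  \<comment> \<open>An eigenvalue of \<open>A\<close> that \<open>C\<close> lacks has multiplicity 0 in \<open>C\<close>. Hence the bound on \<open>alg_mult C\<close>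
    can be summed over the whole spectrum of \<open>A\<close>, shared or not.\<close>
  have shared: "(\<Sum>\<mu>\<in>spectrum A. ?a \<mu>) = (\<Sum>\<mu>\<in>spectrum C \<inter> spectrum A. ?a \<mu>)"
    by (rule sum.mono_neutral_right) (use finA alg_mult_pos_iff[OF C] in auto)
  have "int (card (spectrum C - spectrum A)) = (\<Sum>\<mu>\<in>spectrum C - spectrum A. 1)"
    by simp
  also have "\<dots> \<le> (\<Sum>\<mu>\<in>spectrum C - spectrum A. ?a \<mu>)"
    by (rule sum_mono) (use alg_mult_pos_iff[OF C] in \<open>auto simp: Suc_le_eq\<close>)
  also have "\<dots> = (\<Sum>\<mu>\<in>spectrum C. ?a \<mu>) - (\<Sum>\<mu>\<in>spectrum A. ?a \<mu>)"
    unfolding shared using sum.Int_Diff[OF finC, of ?a "spectrum A"] by simp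
  also have "(\<Sum>\<mu>\<in>spectrum C. ?a \<mu>) = int n"
    using sum_alg_mult_spectrum[OF C] by (simp flip: of_nat_sum)
  also have "int n = (\<Sum>\<mu>\<in>spectrum A. int (alg_mult A \<mu>))"
    using sum_alg_mult_spectrum[OF A] by (simp flip: of_nat_sum)
  finally have new: "int (card (spectrum C - spectrum A))
      \<le> (\<Sum>\<mu>\<in>spectrum A. int (alg_mult A \<mu>) - ?a \<mu>)"
    by (simp add: sum_subtractf)
  have "\<dots> \<le> (\<Sum>\<mu>\<in>spectrum A. eig_defectivity A \<mu> + ?r)"
  proof (rule sum_mono)
    fix \<mu>
    have "geom_mult A \<mu> \<le> geom_mult C \<mu> + vec_space.rank n B" "geom_mult C \<mu> \<le> alg_mult C \<mu>"
      using geom_mult_le_geom_mult_add[OF A B] geom_mult_le_alg_mult[OF C] assms(3) by auto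
    then show "int (alg_mult A \<mu>) - ?a \<mu> \<le> eig_defectivity A \<mu> + ?r"
      unfolding eig_defectivity_def by linarith
  qed
  also have "\<dots> = defectivity A + ?r * int (card (spectrum A))"
    by (simp add: defectivity_def sum.distrib)
  finally have "int (card (spectrum C - spectrum A)) \<le> defectivity A + ?r * int (card (spectrum A))"
    using new by linarith
  moreover have "card (spectrum C) \<le> card (spectrum A) + card (spectrum C - spectrum A)"
    by (metis Un_Diff_cancel card_Un_le card_mono finA finC finite_Un le_trans sup.cobounded2)
  ultimately show ?thesis
    by (simp add: algebra_simps)
qed

end
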